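(* Let $k,l$ be coprime positive integers with $k>1$, $kl$ odd and not a perfect square, and suppose the equation $kx^2-ly^2=4$ is solvable in odd integers $x,y$. Let $(x_1,y_1)$ be its minimal positive solution and $\varepsilon=x_1\sqrt{k}+y_1\sqrt{l}$. Let $(x,y)$ be a positive integer solution of $kx^2-ly^2=4$. (i) If $x=p^nx'$, where $p$ is a prime not dividing $k$, $n$ is a positive integer, $x'$ is a positive integer and every prime divisor of $x'$ divides $k$, then $\frac{x\sqrt{k}+y\sqrt{l}}{2}=\frac{\varepsilon}{2}$ or $\frac{x\sqrt{k}+y\sqrt{l}}{2}=\left(\frac{\varepsilon}{2}\right)^q$ for some odd prime $q\neq p$, except for $(k,l,x,y)=(5,1,75025,167761)$. (ii) If $y=p^ny'$, where $p$ is a prime not dividing $l$, $n$ is a positive integer, $y'$ is a positive integer and every prime divisor of $y'$ divides $l$, then $\frac{x\sqrt{k}+y\sqrt{l}}{2}=\frac{\varepsilon}{2}$ or $\frac{x\sqrt{k}+y\sqrt{l}}{2}=\left(\frac{\varepsilon}{2}\right)^q$ for some odd prime $q\neq p$.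
   Context: The minimal positive solution of $kx^2-ly^2=4$ is the solution $(x_1,y_1)$ in positive integers for which $x_1\sqrt{k}+y_1\sqrt{l}$ is smallest. *)

theory Defs
  imports Complex_Main "HOL-Computational_Algebra.Primes"
begin

definition pos_sol :: "int \<Rightarrow> int \<Rightarrow> int \<Rightarrow> int \<Rightarrow> bool" where
  "pos_sol k l x y \<longleftrightarrow> x > 0 \<and> y > 0 \<and> k * x\<^sup>2 - l * y\<^sup>2 = 4"

definition sol_val :: "int \<Rightarrow> int \<Rightarrow> int \<Rightarrow> int \<Rightarrow> real" where
  "sol_val k l x y = of_int x * sqrt (of_int k) + of_int y * sqrt (of_int l)"

text \<open>Minimality is among all positive integer solutions, of either parity.\<close>

definition minimal_pos_sol :: "int \<Rightarrow> int \<Rightarrow> int \<Rightarrow> int \<Rightarrow> bool" where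
  "minimal_pos_sol k l x y \<longleftrightarrow>
     pos_sol k l x y \<and> (\<forall>u v. pos_sol k l u v \<longrightarrow> sol_val k l x y \<le> sol_val k l u v)"

end

theory Submission
  imports Defs
begin

text \<open>
  Write \<open>\<alpha> = \<epsilon> / 2\<close>. A descent by \<open>\<alpha>\<^sup>-\<^sup>2\<close> shows that every solution is an odd power \<open>\<alpha>\<^sup>m\<close>; its
  coordinates are \<open>y = y1 * L(l * y1\<^sup>2, m)\<close> and \<open>x = \<plusminus> x1 * L(- k * x1\<^sup>2, m)\<close>, where
  \<open>L(c, m) = (z\<^sup>m - z\<^sup>-\<^sup>m) / (z - z\<^sup>-\<^sup>1)\<close> with \<open>(z - z\<^sup>-\<^sup>1)\<^sup>2 = c\<close> is a Lehmer number. So both parts of the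
  theorem are one statement about \<open>L(c, m)\<close> for odd \<open>c \<ge> 1\<close> or \<open>c \<le> -5\<close>.

  If \<open>m\<close> is prime and \<open>L(c, m)\<close> is, up to sign, a power of \<open>m\<close>, then \<open>m\<close> divides \<open>c\<close>, and
  \<open>m\<^sup>2\<close> does not divide \<open>L(c, m)\<close> for \<open>m \<ge> 5\<close>; by size only \<open>L(-5, 5) = 5\<close> remains, besides some cases
  with \<open>m = 3\<close>. If \<open>m\<close> is composite and \<open>q\<close> is a prime factor, then
  \<open>L(c, m) = L(c, m/q) * L(c', q)\<close> with \<open>c' = c * L(c, m/q)\<^sup>2\<close>. The second factor involves only the primes
  \<open>p\<close> and \<open>q\<close>, and must involve \<open>p\<close>, so \<open>p\<close> cannot divide \<open>c'\<close>. Hence for every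
  proper divisor \<open>d\<close> of \<open>m\<close>, \<open>L(c, d)\<close> is composed of primes dividing \<open>c\<close>; taking \<open>d\<close> prime forces
  \<open>d = 5\<close>, \<open>c = -5\<close> (the case \<open>d = 3\<close> fails because \<open>c + 3\<close> is even). Since \<open>L(-5, 25) = 25 * 3001\<close>,
  the only composite index is \<open>m = 25\<close>, which is the exception.
\<close>

section \<open>Lehmer numbers of odd index\<close>

text \<open>\<open>lehmer_aux c j\<close> is the Lehmer number of index 2j + 1; the factor
  \<open>c + 2\<close> is z^2 + z^-2.\<close>

fun lehmer_aux :: "int \<Rightarrow> nat \<Rightarrow> int" where
  "lehmer_aux c 0 = 1"
| "lehmer_aux c (Suc 0) = c + 3"
| "lehmer_aux c (Suc (Suc j)) = (c + 2) * lehmer_aux c (Suc j) - lehmer_aux c j"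

text \<open>\<open>lehmer c m\<close> is meaningful for odd \<open>m\<close> only; an even index is rounded up to the next odd one.\<close>

definition lehmer :: "int \<Rightarrow> nat \<Rightarrow> int" where
  "lehmer c m = lehmer_aux c (m div 2)"

lemma lehmer_odd_index: "lehmer c (2 * j + 1) = lehmer_aux c j"
  by (simp add: lehmer_def)

lemma lehmer_3: "lehmer c 3 = c + 3"
  using lehmer_odd_index[of c 1] by simp

lemma lehmer_5: "lehmer c 5 = c * (c + 5) + 5"
  using lehmer_odd_index[of c 2] by (simp add: eval_nat_numeral algebra_simps)

text \<open>
  With \<open>\<alpha> * \<beta> = 1\<close>, the choice \<open>z = \<alpha>\<close>, \<open>w = \<beta>\<close>, \<open>\<sigma> = 1\<close> yields the second coordinate of a solution and
  \<open>z = \<alpha>\<close>, \<open>w = - \<beta>\<close>, \<open>\<sigma> = -1\<close> the first.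
\<close>

lemma lehmer_aux_closed_form:
  fixes z w \<sigma> :: "'a :: comm_ring_1"
  assumes zw: "z * w = \<sigma>" and \<sigma>: "\<sigma> * \<sigma> = 1" and c: "(z - w)\<^sup>2 = \<sigma> * of_int c"
  shows "(z - w) * (\<sigma> ^ j * of_int (lehmer_aux c j)) = z ^ (2 * j + 1) - w ^ (2 * j + 1)"
proof (induction j rule: induct_nat_012)
  case 0
  then show ?case by simp
next
  case 1
  have "z ^ 3 - w ^ 3 = (z - w) * ((z - w)\<^sup>2 + 3 * (z * w))"
    by (simp add: algebra_simps power2_eq_square power3_eq_cube)
  also have "\<dots> = (z - w) * (\<sigma> ^ 1 * of_int (lehmer_aux c 1))"
    unfolding zw c by (simp add: algebra_simps)
  finally show ?case by (simp add: eval_nat_numeral)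
next
  case (ge2 j)
  have *: "z\<^sup>2 + w\<^sup>2 = \<sigma> * (of_int c + 2)"
  proof -
    have "z\<^sup>2 + w\<^sup>2 = (z - w)\<^sup>2 + 2 * (z * w)"
      by (simp add: algebra_simps power2_eq_square)
    then show ?thesis unfolding zw c by (simp add: algebra_simps)
  qed
  have "z ^ (2 * Suc (Suc j) + 1) - w ^ (2 * Suc (Suc j) + 1)
      = (z\<^sup>2 + w\<^sup>2) * (z ^ (2 * Suc j + 1) - w ^ (2 * Suc j + 1))
        - (z * w) * (z * w) * (z ^ (2 * j + 1) - w ^ (2 * j + 1))"
    by (simp add: algebra_simps power2_eq_square)
  also have "\<dots> = \<sigma> * (of_int c + 2) * ((z - w) * (\<sigma> ^ Suc j * of_int (lehmer_aux c (Suc j))))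
        - (\<sigma> * \<sigma>) * ((z - w) * (\<sigma> ^ j * of_int (lehmer_aux c j)))"
    unfolding ge2[symmetric] * zw by simp
  also have "\<dots> = (z - w) * (\<sigma> ^ Suc (Suc j) * of_int (lehmer_aux c (Suc (Suc j))))"
    by (simp add: algebra_simps)
  finally show ?case ..
qed

text \<open>If z w = 1 and z - w is a square root of c, then z^n and w^n form such a pair for c *
  L(c, n)^2. The roots are complex because c may be negative.\<close>

lemma lehmer_mult:
  assumes "odd m" and "odd n" and "c \<noteq> 0"
  shows "lehmer c (n * m) = lehmer c n * lehmer (c * (lehmer c n)\<^sup>2) m"
proof -
  define s z w where "s = csqrt (of_int c)"
    and "z = (csqrt (of_int c + 4) + s) / 2" and "w = (csqrt (of_int c + 4) - s) / 2"
  have s2: "s\<^sup>2 = of_int c" and s0: "s \<noteq> 0"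
    using assms(3) by (auto simp: s_def)
  have zw: "z * w = 1"
  proof -
    have "z * w = ((csqrt (of_int c + 4))\<^sup>2 - s\<^sup>2) / 4"
      by (simp add: z_def w_def power2_eq_square algebra_simps)
    also have "\<dots> = 1" unfolding s2 power2_csqrt by simp
    finally show ?thesis .
  qed
  have zs: "z - w = s" by (simp add: z_def w_def field_simps)
  have L: "s * of_int (lehmer c r) = z ^ r - w ^ r" if "odd r" for r
    using lehmer_aux_closed_form[OF zw, of c "r div 2"] that
    by (simp add: zs s2 lehmer_def)
  have zw': "z ^ n * w ^ n = 1" by (simp add: zw flip: power_mult_distrib)
  have c': "(z ^ n - w ^ n)\<^sup>2 = of_int (c * (lehmer c n)\<^sup>2)"
    by (simp add: L[OF assms(2), symmetric] power_mult_distrib s2)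
  have "(z ^ n - w ^ n) * of_int (lehmer (c * (lehmer c n)\<^sup>2) m) = (z ^ n) ^ m - (w ^ n) ^ m"
    using lehmer_aux_closed_form[OF zw', of "c * (lehmer c n)\<^sup>2" "m div 2"] c' assms(1)
    by (simp add: lehmer_def)
  also have "\<dots> = s * of_int (lehmer c (n * m))"
    using assms by (simp add: L flip: power_mult)
  finally have "s * of_int (lehmer c n * lehmer (c * (lehmer c n)\<^sup>2) m)
      = s * of_int (lehmer c (n * m))"
    by (simp flip: L[OF assms(2)])
  then have "(of_int (lehmer c n * lehmer (c * (lehmer c n)\<^sup>2) m) :: complex)
      = of_int (lehmer c (n * m))"
    using s0 by (simp only: mult_cancel_left) simp
  then show ?thesis by (simp only: of_int_eq_iff)
qed

section \<open>Congruences modulo c and parity\<close>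

text \<open>Modulo c the recurrence is that of an arithmetic progression, here 1, 3, 5, ...\<close>

lemma lehmer_cong: "c dvd lehmer c m - int (2 * (m div 2) + 1)"
proof -
  have "c dvd lehmer_aux c j - int (2 * j + 1)" for j
  proof (induction j rule: induct_nat_012)
    case (ge2 j)
    have "lehmer_aux c (Suc (Suc j)) - int (2 * Suc (Suc j) + 1)
      = c * lehmer_aux c (Suc j) + 2 * (lehmer_aux c (Suc j) - int (2 * Suc j + 1))
        - (lehmer_aux c j - int (2 * j + 1))"
      by (simp add: algebra_simps)
    then show ?case using ge2 by (simp only: dvd_add dvd_diff dvd_mult dvd_triv_left)
  qed simp_all
  then show ?thesis by (simp add: lehmer_def)
qed

lemma prime_dvd_lehmer_imp_dvd_index:
  assumes "odd m" and "r dvd c" and "r dvd lehmer c m"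
  shows "r dvd int m"
proof -
  have "r dvd lehmer c m - int m"
    using dvd_trans[OF assms(2) lehmer_cong[of c m]] assms(1) by simp
  then show ?thesis using dvd_diff[OF assms(3)] by fastforce
qed

text \<open>For even c the value is congruent to its odd index; for odd c the recurrence modulo 2
  repeats 1, 0, 1.\<close>

lemma even_lehmer_aux_imp:
  assumes "even (lehmer_aux c j)"
  shows "odd c \<and> j mod 3 = 1"
proof (cases "even c")
  case True
  then show ?thesis using assms
    using dvd_trans[OF True lehmer_cong[of c "2 * j + 1"]] by (simp add: lehmer_def)
next
  case False
  have "even (lehmer_aux c j) \<longleftrightarrow> j mod 3 = 1" for j
  proof (induction j rule: less_induct)
    case (less j)
    show ?case
    proof (cases "j < 3")
      case True
      then have "j = 0 \<or> j = Suc 0 \<or> j = Suc (Suc 0)" by auto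
      then show ?thesis using False by auto
    next
      case ge: False
      then obtain i where i: "j = Suc (Suc (Suc i))"
        using that[of "j - 3"] by (simp add: eval_nat_numeral)
      have "even (lehmer_aux c j) \<longleftrightarrow> even (lehmer_aux c i)"
        using False by (auto simp: i)
      then show ?thesis using less[of i] by (simp add: i)
    qed
  qed
  then show ?thesis using False assms by auto
qed

lemma odd_lehmer:
  assumes "odd m" and "\<not> 3 dvd m"
  shows "odd (lehmer c m)"
proof
  assume "even (lehmer c m)"
  then have "(m div 2) mod 3 = 1" using even_lehmer_aux_imp by (auto simp: lehmer_def)
  then show False using assms by presburger
qed

section \<open>Expansion in powers of c and congruences for prime index\<close>

text \<open>By Pascal's rule the two binomial sums \<open>P\<close> and \<open>Q\<close> satisfy a
  first-order system in j, which yields the recurrence for P + 2Q.\<close>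

lemma lehmer_aux_binomial_sum:
  "lehmer_aux c j = (\<Sum>i\<le>j. int (((j + i) choose (2 * i)) + 2 * ((j + i) choose (2 * i + 1))) * c ^ i)"
proof -
  define P where "P j = (\<Sum>i\<le>j. int ((j + i) choose (2 * i)) * c ^ i)" for j
  define Q where "Q j = (\<Sum>i\<le>j. int ((j + i) choose (2 * i + 1)) * c ^ i)" for j
  have P0: "P 0 = 1" and Q0: "Q 0 = 0" by (simp_all add: P_def Q_def)
  have Q: "Q (Suc j) = Q j + P j" for j
    by (simp add: P_def Q_def sum.distrib binomial_eq_0 algebra_simps)
  have P: "P (Suc j) = P j + c * Q (Suc j)" for j
  proof -
    have "P (Suc j) = 1 + (\<Sum>i\<le>j. int ((Suc j + Suc i) choose (2 * Suc i)) * c ^ Suc i)"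
      unfolding P_def by (subst sum.atMost_Suc_shift) simp
    also have "\<dots> = (1 + (\<Sum>i\<le>j. int ((j + Suc i) choose (2 * Suc i)) * c ^ Suc i))
        + c * (\<Sum>i\<le>j. int ((Suc j + i) choose (2 * i + 1)) * c ^ i)"
      by (simp add: sum.distrib sum_distrib_left algebra_simps)
    also have "1 + (\<Sum>i\<le>j. int ((j + Suc i) choose (2 * Suc i)) * c ^ Suc i)
        = (\<Sum>i\<le>Suc j. int ((j + i) choose (2 * i)) * c ^ i)"
      by (subst sum.atMost_Suc_shift) simp
    also have "\<dots> = P j" by (simp add: P_def binomial_eq_0)
    also have "(\<Sum>i\<le>j. int ((Suc j + i) choose (2 * i + 1)) * c ^ i) = Q (Suc j)"
      by (simp add: Q_def binomial_eq_0)
    finally show ?thesis .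
  qed
  have "lehmer_aux c j = P j + 2 * Q j"
  proof (induction j rule: induct_nat_012)
    case (ge2 j)
    then show ?case by (simp add: P Q algebra_simps)
  qed (simp_all add: P0 Q0 P Q)
  then show ?thesis
    unfolding P_def Q_def sum_distrib_left sum.distrib[symmetric]
    by (simp add: algebra_simps)
qed

text \<open>The coefficient of c^i is (2j+1)/(2i+1) times a binomial coefficient; clearing the
  denominator exposes the factor 2j+1.\<close>

lemma lehmer_coefficient:
  assumes "i \<le> j"
  shows "(2 * i + 1) * (((j + i) choose (2 * i)) + 2 * ((j + i) choose (2 * i + 1)))
    = (2 * j + 1) * ((j + i) choose (2 * i))"
proof -
  have "(2 * i + 1) * ((j + i) choose (2 * i + 1)) = (j - i) * ((j + i) choose (2 * i))"
    using binomial_absorb_comp[of "j + i" "2 * i"] binomial_absorption[of "2 * i" "j + i"]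
    by simp
  then have "(2 * i + 1) * (((j + i) choose (2 * i)) + 2 * ((j + i) choose (2 * i + 1)))
     = (2 * i + 1 + 2 * (j - i)) * ((j + i) choose (2 * i))"
    by (simp add: algebra_simps)
  also have "2 * i + 1 + 2 * (j - i) = 2 * j + 1" using assms by simp
  finally show ?thesis .
qed

lemma prime_dvd_lehmer_coefficient:
  assumes "prime (2 * j + 1)" and "i < j"
  shows "(2 * j + 1) dvd (((j + i) choose (2 * i)) + 2 * ((j + i) choose (2 * i + 1)))"
proof -
  have "(2 * j + 1) dvd (2 * i + 1) * (((j + i) choose (2 * i)) + 2 * ((j + i) choose (2 * i + 1)))"
    using lehmer_coefficient[of i j] assms(2) by (metis dvd_triv_left less_imp_le)
  moreover have "\<not> (2 * j + 1) dvd (2 * i + 1)"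
    using assms(2) by (auto dest: dvd_imp_le)
  ultimately show ?thesis using prime_dvd_mult_iff[OF assms(1)] by blast
qed

text \<open>Every coefficient below the leading one, which is 1, is divisible by q.\<close>

lemma lehmer_prime_cong_power:
  assumes "prime q" and "odd q"
  shows "int q dvd lehmer c q - c ^ (q div 2)"
proof -
  obtain j where q: "q = 2 * j + 1" using assms(2) by (auto elim: oddE)
  have "lehmer c q - c ^ j
    = (\<Sum>i<j. int (((j + i) choose (2 * i)) + 2 * ((j + i) choose (2 * i + 1))) * c ^ i)"
    unfolding q lehmer_odd_index lehmer_aux_binomial_sum
    by (simp add: lessThan_Suc_atMost[symmetric] binomial_eq_0 flip: mult_2)
  moreover have "int q dvd \<dots>"
    using prime_dvd_lehmer_coefficient[of j] assms(1)
    by (intro dvd_sum dvd_mult2) (simp add: q del: of_nat_add of_nat_mult of_nat_Suc)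
  ultimately show ?thesis by (simp add: q)
qed

text \<open>The constant term is q, the linear term has one factor q in its coefficient and one in
  c, and later terms contain c^2. For q >= 5 the linear term is not the leading one.\<close>

lemma lehmer_prime_cong_square:
  assumes "prime q" and "q \<ge> 5" and "int q dvd c"
  shows "(int q)\<^sup>2 dvd lehmer c q - int q"
proof -
  have "odd q" using assms(1,2) prime_odd_nat by auto
  then obtain j where q: "q = 2 * j + 1" by (auto elim: oddE)
  then have j: "j \<ge> 2" using assms(2) by simp
  define a where "a i = int (((j + i) choose (2 * i)) + 2 * ((j + i) choose (2 * i + 1)))" for i
  have "lehmer c q = (\<Sum>i\<le>j. a i * c ^ i)"
    unfolding q lehmer_odd_index lehmer_aux_binomial_sum a_def ..
  also have "{..j} = insert 0 {1..j}" by auto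
  also have "(\<Sum>i\<in>insert 0 {1..j}. a i * c ^ i) = int q + (\<Sum>i\<in>{1..j}. a i * c ^ i)"
    by (simp add: a_def q)
  finally have "lehmer c q - int q = (\<Sum>i\<in>{1..j}. a i * c ^ i)" by simp
  moreover have "(int q)\<^sup>2 dvd a i * c ^ i" if i: "i \<in> {1..j}" for i
  proof (cases "i = 1")
    case True
    have "int q dvd a i"
      using prime_dvd_lehmer_coefficient[of j i] assms(1) j True
      unfolding q a_def by (simp only: of_nat_dvd_iff)
    then show ?thesis using assms(3) True by (simp add: power2_eq_square mult_dvd_mono)
  next
    case False
    then have "(int q)\<^sup>2 dvd c ^ i"
      using i dvd_power_le[OF assms(3), of 2 i] by simp
    then show ?thesis by simp
  qed
  ultimately show ?thesis by (auto intro!: dvd_sum)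
qed

section \<open>Lower bounds\<close>

text \<open>Each step raises the increment by \<open>c * lehmer_aux c (Suc j)\<close>, so increments
  stay at least 3, against a slope of 2 on the right.\<close>

lemma lehmer_aux_pos_gt:
  assumes "c \<ge> 1" and "j \<ge> 1"
  shows "lehmer_aux c j > 2 * int j + 1"
proof -
  have "lehmer_aux c j \<ge> 3 * int j + 1 \<and> lehmer_aux c (Suc j) \<ge> lehmer_aux c j + 3" for j
  proof (induction j)
    case 0
    then show ?case using assms(1) by simp
  next
    case (Suc j)
    then have "c * lehmer_aux c (Suc j) \<ge> 0" using assms(1) by simp
    then show ?case using Suc by (simp add: algebra_simps)
  qed
  from this[of j] show ?thesis using assms(2) by linarith
qed

text \<open>The signs alternate. With them removed, the recurrence has the factor -c - 2 >= 3, and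
  three times a term minus its smaller predecessor is at least twice the term.\<close>

lemma lehmer_aux_neg_doubling:
  assumes "c \<le> -5"
  shows "\<bar>lehmer_aux c j\<bar> \<ge> 1 \<and> \<bar>lehmer_aux c (Suc j)\<bar> \<ge> 2 * \<bar>lehmer_aux c j\<bar>"
proof -
  define U where "U j = (-1) ^ j * lehmer_aux c j" for j
  have rec: "U (Suc (Suc j)) = (- c - 4) * U (Suc j) + 2 * U (Suc j) - U j" for j
    by (simp add: U_def algebra_simps)
  have U: "U j \<ge> 1 \<and> U (Suc j) \<ge> 2 * U j" for j
  proof (induction j)
    case 0
    then show ?case using assms by (simp add: U_def)
  next
    case (Suc j)
    then have "(- c - 4) * U (Suc j) \<ge> 1 * U (Suc j)"
      using assms by (intro mult_right_mono) auto
    then show ?case using Suc rec[of j] by linarith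
  qed
  have "\<bar>lehmer_aux c j\<bar> = U j" for j
  proof -
    have "\<bar>lehmer_aux c j\<bar> = \<bar>U j\<bar>" by (simp add: U_def abs_mult)
    then show ?thesis using U[of j] by simp
  qed
  then show ?thesis using U by simp
qed

text \<open>Doubling keeps the lead over 2j+1. The start is j = 3 because L(-5, 5) = 5 gives
  equality at j = 2.\<close>

lemma lehmer_aux_neg_gt:
  assumes "c \<le> -5" and "j \<ge> 3"
  shows "\<bar>lehmer_aux c j\<bar> > 2 * int j + 1"
  using assms(2)
proof (induction j rule: dec_induct)
  case base
  have "c * (c + 5) \<ge> 0" using assms(1) by (simp add: mult_nonpos_nonpos)
  then have "\<bar>lehmer_aux c 2\<bar> \<ge> 5"
    by (simp add: numeral_2_eq_2 algebra_simps)
  then show ?case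
    using lehmer_aux_neg_doubling[OF assms(1), of 2] by (simp add: numeral_3_eq_3 numeral_2_eq_2)
next
  case (step j)
  then show ?case using lehmer_aux_neg_doubling[OF assms(1), of j] by simp
qed

lemma abs_lehmer_gt_1:
  assumes "c \<ge> 1 \<or> c \<le> -5" and "odd m" and "m > 1"
  shows "\<bar>lehmer c m\<bar> > 1"
proof -
  obtain j where m: "m = 2 * Suc j + 1"
    using assms(2,3) that[of "m div 2 - 1"] by (auto elim!: oddE)
  have "\<bar>lehmer_aux c (Suc j)\<bar> > 1"
    using assms(1)
  proof
    assume "c \<ge> 1"
    then show ?thesis using lehmer_aux_pos_gt[of c "Suc j"] by simp
  next
    assume "c \<le> -5"
    then show ?thesis using lehmer_aux_neg_doubling[of c j] by linarith
  qed
  then show ?thesis by (simp only: m lehmer_odd_index)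
qed

lemma abs_lehmer_gt_index:
  assumes c: "c \<ge> 1 \<or> c \<le> -5" and m: "odd m" "m \<ge> 5" and ex: "\<not> (c = -5 \<and> m = 5)"
  shows "\<bar>lehmer c m\<bar> > int m"
proof -
  obtain j where j: "m = 2 * j + 1" using m(1) by (auto elim: oddE)
  have "j \<ge> 2" using m(2) j by simp
  consider "c \<ge> 1" | "c \<le> -5" "j \<ge> 3" | "c < -5" "j = 2"
    using c ex \<open>j \<ge> 2\<close> j by force
  then have "\<bar>lehmer_aux c j\<bar> > 2 * int j + 1"
  proof cases
    case 1
    then show ?thesis using lehmer_aux_pos_gt[of c j] \<open>j \<ge> 2\<close> by simp
  next
    case 2
    then show ?thesis using lehmer_aux_neg_gt[of c j] by simp
  next
    case 3
    then have "c * (c + 5) > 0" by (simp add: mult_neg_neg)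
    then show ?thesis using 3 by (simp add: numeral_2_eq_2 algebra_simps)
  qed
  then show ?thesis by (simp add: j lehmer_odd_index[simplified])
qed

section \<open>Lehmer numbers with few prime divisors\<close>

lemma lehmer_dvd:
  assumes "odd m" and "d dvd m" and "c \<noteq> 0"
  shows "lehmer c d dvd lehmer c m"
proof -
  obtain e where "m = d * e" using assms(2) by (elim dvdE)
  then show ?thesis using lehmer_mult[of e d c] assms(1,3) by simp
qed

lemma exists_prime_divisor_int:
  assumes "\<bar>a::int\<bar> \<noteq> 1"
  obtains r where "prime r" and "r dvd a"
proof (cases "a = 0")
  case True
  then show ?thesis using that[of 2] by simp
next
  case False
  then show ?thesis using prime_divisor_exists[of a] assms that by auto
qed

lemma abs_eq_prime_if_only_prime_divisor:
  fixes q a :: int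
  assumes q: "prime q" and only: "\<And>r. prime r \<Longrightarrow> r dvd a \<Longrightarrow> r = q"
    and dvd: "q dvd a" and sq: "\<not> q\<^sup>2 dvd a"
  shows "\<bar>a\<bar> = q"
proof -
  obtain u where u: "a = q * u" using dvd by (elim dvdE)
  have "\<bar>u\<bar> = 1"
  proof (rule ccontr)
    assume "\<bar>u\<bar> \<noteq> 1"
    then obtain r where r: "prime r" "r dvd u" by (rule exists_prime_divisor_int)
    then have "q dvd u" using only[of r] u by simp
    then show False using sq u by (simp add: power2_eq_square)
  qed
  then show ?thesis using u prime_gt_0_int[OF q] by (simp add: abs_mult)
qed

text \<open>The congruence modulo q gives that q divides c. For q >= 5 the one modulo q^2 leaves
  only the absolute value q, which the lower bound restricts to L(-5, 5). For q = 3 the value is c +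
  3.\<close>

lemma lehmer_prime_index_power:
  assumes q: "prime q" "odd q" and c: "c \<ge> 1 \<or> c \<le> -5"
    and only: "\<And>r. prime r \<Longrightarrow> r dvd lehmer c q \<Longrightarrow> r = int q"
  shows "int q dvd c \<and> \<not> (int q)\<^sup>2 dvd c \<and> (q = 3 \<or> q = 5 \<and> c = -5)"
proof -
  have q1: "q > 1" using q(1) prime_gt_1_nat by blast
  have "\<bar>lehmer c q\<bar> > 1" using abs_lehmer_gt_1[OF c q(2) q1] .
  then obtain r where "prime r" "r dvd lehmer c q" by (metis exists_prime_divisor_int less_irrefl)
  with only have qL: "int q dvd lehmer c q" by blast
  have "int q dvd c ^ (q div 2)"
    using dvd_diff[OF qL lehmer_prime_cong_power[OF q, of c]] by simp
  then have qc: "int q dvd c" using q(1) prime_dvd_power[of "int q"] by simp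
  have L: "\<bar>lehmer c q\<bar> = int q" if "\<not> (int q)\<^sup>2 dvd lehmer c q"
    using abs_eq_prime_if_only_prime_divisor[of "int q" "lehmer c q"] only qL q(1) that by simp
  have q2: "\<not> (int q)\<^sup>2 dvd int q"
    using q1 by (auto dest!: zdvd_imp_le simp: power2_eq_square)
  have "q = 3 \<or> q \<ge> 5"
  proof -
    have "q \<noteq> 2" "q \<noteq> 4" using q(2) by auto
    then show ?thesis using q1 by linarith
  qed
  then show ?thesis
  proof
    assume [simp]: "q = 3"
    have "\<not> 9 dvd c"
    proof
      assume 9: "9 dvd c"
      then have "\<not> 9 dvd c + 3" by presburger
      then have "\<bar>c + 3\<bar> = 3" using L by (simp add: lehmer_3)
      then have "c = 0 \<or> c = -6" by linarith
      then show False using 9 c by auto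
    qed
    then show ?thesis using qc by simp
  next
    assume q5: "q \<ge> 5"
    have "\<not> (int q)\<^sup>2 dvd lehmer c q"
      using dvd_diff[OF _ lehmer_prime_cong_square[OF q(1) q5 qc], of "lehmer c q"] q2 by auto
    then have "c = -5 \<and> q = 5"
      using L abs_lehmer_gt_index[OF c q(2) q5] by auto
    then show ?thesis by auto
  qed
qed

text \<open>Assumption \<open>p2\<close> holds for c = d * w^2 with p not dividing d, the form in
  which c arises up to sign. It excludes that p is the index of a prime-index factor, since the
  parameter would then contain p exactly once.\<close>

lemma lehmer_few_primes_index:
  assumes c_odd: "odd c" and c: "c \<ge> 1 \<or> c \<le> -5"
    and p: "prime (p::int)" and p2: "p dvd c \<Longrightarrow> p\<^sup>2 dvd c"
    and m: "odd m" "m > 1"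
    and only: "\<And>r. prime r \<Longrightarrow> r dvd lehmer c m \<Longrightarrow> r = p \<or> r dvd c"
  shows "(prime m \<and> int m \<noteq> p) \<or> (c = -5 \<and> m = 25)"
proof (cases "prime m")
  case True
  have "int m \<noteq> p"
  proof
    assume mp: "int m = p"
    have "r = int m" if "prime r" "r dvd lehmer c m" for r
      using only[OF that] prime_dvd_lehmer_imp_dvd_index[OF m(1) _ that(2)] mp
        primes_dvd_imp_eq[OF that(1) p] by auto
    then show False
      using lehmer_prime_index_power[OF True m(1) c] p2 mp by blast
  qed
  then show ?thesis using True by simp
next
  case False
  have c0: "c \<noteq> 0" using c by auto
  define c' where "c' q = c * (lehmer c (m div q))\<^sup>2" for q
  have q_odd: "odd q" if "q dvd m" for q
    using m(1) that dvd_trans by blast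
  \<comment> \<open>The strict bound \<open>c' q < -5\<close> keeps the exceptional pair (-5, 5)
    away from the cofactor; it holds since L(c, m/q) has absolute value at least 2.\<close>
  have idx: "odd (m div q)" "m div q > 1" "lehmer c (m div q) dvd lehmer c m"
    "lehmer c m = lehmer c (m div q) * lehmer (c' q) q"
    "c' q \<ge> 1 \<or> c' q < -5" if q: "prime q" "q dvd m" for q
  proof -
    obtain e where e: "m = q * e" using q(2) by (elim dvdE)
    have e': "m div q = e" using e q(1) prime_gt_0_nat[of q] by simp
    show o: "odd (m div q)" using m(1) e e' by simp
    have "e \<noteq> 1" "e \<noteq> 0" using e q(1) False m(2) by auto
    then show gt: "m div q > 1" using e' by simp
    show "lehmer c (m div q) dvd lehmer c m"
      using lehmer_dvd[OF m(1) _ c0, of e] e e' by simp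
    show "lehmer c m = lehmer c (m div q) * lehmer (c' q) q"
      using lehmer_mult[OF q_odd[OF q(2)] o c0] e e' by (simp add: c'_def mult.commute)
    have "\<bar>lehmer c (m div q)\<bar> \<ge> 2"
      using abs_lehmer_gt_1[OF c o gt] by linarith
    then have 4: "(lehmer c (m div q))\<^sup>2 \<ge> 4"
      using power_mono[of 2 "\<bar>lehmer c (m div q)\<bar>" 2] by simp
    show "c' q \<ge> 1 \<or> c' q < -5"
      using c
    proof
      assume "c \<ge> 1"
      then have "c' q > 0" using 4 unfolding c'_def by (intro mult_pos_pos) auto
      then show ?thesis by simp
    next
      assume "c \<le> -5"
      then have "c' q \<le> -5 * (lehmer c (m div q))\<^sup>2"
        unfolding c'_def by (intro mult_right_mono) auto
      then show ?thesis using 4 by linarith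
    qed
  qed
  have adm: "c' q \<ge> 1 \<or> c' q \<le> -5" "c' q \<noteq> -5" if "prime q" "q dvd m" for q
    using idx(5)[OF that] by auto
  have only': "r = p \<or> r = int q"
    if q: "prime q" "q dvd m" and r: "prime r" "r dvd lehmer (c' q) q" for q r
  proof -
    have "r dvd lehmer c m" using idx(4)[OF q] r(2) by simp
    then consider "r = p" | "r dvd c" using only[OF r(1)] by blast
    then show ?thesis
    proof cases
      case 2
      then have "r dvd c' q" by (simp add: c'_def)
      then have "r dvd int q"
        using prime_dvd_lehmer_imp_dvd_index[OF q_odd[OF q(2)] _ r(2)] by simp
      then show ?thesis using primes_dvd_imp_eq[OF r(1)] q(1) by simp
    qed simp
  qed
  have p_dvd: "p dvd lehmer (c' q) q" if q: "prime q" "q dvd m" for q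
  proof (rule ccontr)
    assume np: "\<not> p dvd lehmer (c' q) q"
    then have o: "r = int q" if "prime r" "r dvd lehmer (c' q) q" for r
      using only'[OF q that] that by auto
    have K: "int q dvd c' q" "\<not> (int q)\<^sup>2 dvd c' q" "q = 3"
      using lehmer_prime_index_power[OF q(1) q_odd[OF q(2)] adm(1)[OF q] o] adm(2)[OF q] by auto
    \<comment> \<open>Here \<open>c' q + 3\<close> is up to sign a power of 3. This forces \<open>p = 2\<close>, but \<open>m\<close> also has a prime
      factor \<open>q' \<ge> 5\<close>, whose Lehmer factor is odd.\<close>
    have "odd (c' q + 3)" using o[of 2] K(3) by (auto simp: lehmer_3)
    then have ev: "even (lehmer c (m div q))" using c_odd by (auto simp: c'_def)
    then have "even (lehmer c m)" using idx(3)[OF q] dvd_trans by blast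
    then have p_2: "p = 2" using only[of 2] c_odd by auto
    have n3: "\<not> 3 dvd lehmer c (m div q)"
      using K(2,3) by (auto simp: c'_def power2_eq_square intro: mult_dvd_mono)
    then have "3 dvd c" using K(1,3) prime_dvd_mult_iff[of "3::int"] 
      by (auto simp: c'_def power2_eq_square)
    have n3': "\<not> 3 dvd m div q"
    proof
      assume "3 dvd m div q"
      then have "lehmer c 3 dvd lehmer c (m div q)" using lehmer_dvd idx(1)[OF q] c0 by blast
      then show False using n3 \<open>3 dvd c\<close> by (auto simp: lehmer_3 elim!: dvdE)
    qed
    obtain q' where q': "prime q'" "q' dvd m div q"
      using idx(2)[OF q] prime_factor_nat[of "m div q"] by auto
    then have q'm: "q' dvd m" using q(2) by (metis dvd_mult_div_cancel dvd_mult)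
    have "q' \<noteq> 3" using q'(2) n3' by auto
    then have "\<not> 3 dvd q'" using q'(1) primes_dvd_imp_eq[of 3 q'] by auto
    then have "odd (lehmer (c' q') q')" using odd_lehmer q_odd[OF q'm] by blast
    then have "r = int q'" if "prime r" "r dvd lehmer (c' q') q'" for r
      using only'[OF q'(1) q'm that] that p_2 by auto
    then show False
      using lehmer_prime_index_power[OF q'(1) q_odd[OF q'm] adm(1)[OF q'(1) q'm]]
        adm(2)[OF q'(1) q'm] \<open>q' \<noteq> 3\<close> by auto
  qed
  \<comment> \<open>Otherwise p divides the index q and equals it. Then p^2 cannot divide c',
    although it divides c or L(c, m/q)^2.\<close>
  have p_ndvd: "\<not> p dvd c' q" if q: "prime q" "q dvd m" for q
  proof
    assume pc: "p dvd c' q"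
    have "p dvd int q"
      using prime_dvd_lehmer_imp_dvd_index[OF q_odd[OF q(2)] pc p_dvd[OF q]] .
    then have pq: "p = int q" using primes_dvd_imp_eq[OF p] q(1) by simp
    then have "r = int q" if "prime r" "r dvd lehmer (c' q) q" for r
      using only'[OF q that] by auto
    then have "\<not> p\<^sup>2 dvd c' q"
      using lehmer_prime_index_power[OF q(1) q_odd[OF q(2)] adm(1)[OF q]] pq by auto
    moreover have "p dvd c \<or> p dvd lehmer c (m div q)"
      using pc p by (auto simp: c'_def prime_dvd_mult_iff dest: prime_dvd_power)
    ultimately show False
      using p2 by (auto simp: c'_def dvd_power_same)
  qed
  \<comment> \<open>For a prime factor q2 of m/q, L(c, q) divides L(c, m/q2), which is prime to p.
    So its prime divisors divide c and hence q.\<close>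
  have five: "q = 5 \<and> c = -5" if q: "prime q" "q dvd m" for q
  proof -
    obtain q2 where q2: "prime q2" "q2 dvd m div q"
      using idx(2)[OF q] prime_factor_nat[of "m div q"] by auto
    obtain e where e: "m = q * (q2 * e)" using q2(2) q(2) by (metis dvdE dvd_mult_div_cancel)
    then have q2m: "q2 dvd m" and qd: "q dvd m div q2"
      using prime_gt_0_nat[OF q2(1)] by (simp_all add: mult.left_commute)
    have o: "r = int q" if r: "prime r" "r dvd lehmer c q" for r
    proof -
      have rd: "r dvd lehmer c (m div q2)"
        using r(2) lehmer_dvd[OF idx(1)[OF q2(1) q2m] qd c0] dvd_trans by blast
      then have "r \<noteq> p" using p_ndvd[OF q2(1) q2m] by (auto simp: c'_def power2_eq_square)
      moreover have "r dvd lehmer c m" using rd idx(3)[OF q2(1) q2m] dvd_trans by blast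
      ultimately have "r dvd c" using only[OF r(1)] by blast
      then have "r dvd int q"
        using prime_dvd_lehmer_imp_dvd_index[OF q_odd[OF q(2)] _ r(2)] by simp
      then show ?thesis using primes_dvd_imp_eq[OF r(1)] q(1) by simp
    qed
    have "q \<noteq> 3" using o[of 2] c_odd by (auto simp: lehmer_3)
    then show ?thesis
      using lehmer_prime_index_power[OF q(1) q_odd[OF q(2)] c o] by auto
  qed
  obtain q where "prime q" "q dvd m" using m(2) prime_factor_nat[of m] by auto
  with five have q: "prime (5::nat)" "5 dvd m" and c5: "c = -5" by auto
  obtain q' where q': "prime q'" "q' dvd m div 5"
    using idx(2)[OF q] prime_factor_nat[of "m div 5"] by auto
  then have "q' dvd m" using q(2) by (metis dvd_mult_div_cancel dvd_mult)
  then have "5 dvd m div 5" using five[of q'] q' by auto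
  then obtain e where e: "m = 25 * e" using q(2) by (auto elim!: dvdE)
  show ?thesis
  proof (cases "e = 1")
    case True
    then show ?thesis using e c5 by simp
  next
    case False
    then obtain q'' where q'': "prime q''" "q'' dvd e" using prime_factor_nat[of e] by auto
    then have "5 dvd e" using five[of q''] e by auto
    then have 25: "25 dvd m div 5" using e by (auto elim!: dvdE)
    \<comment> \<open>Since L(-5, 25) divides L(c, m/5), the prime r differs from p and would have
      to divide c = -5.\<close>
    obtain r :: int where r: "prime r" "r dvd 3001"
      by (rule exists_prime_divisor_int[of 3001]) simp_all
    have "lehmer (-5) 25 = 25 * 3001"
      using lehmer_mult[of 5 5 "-5"] by (simp add: lehmer_5)
    then have "r dvd lehmer c 25" unfolding c5 using r(2) by (simp only: dvd_mult)
    then have rd: "r dvd lehmer c (m div 5)"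
      using lehmer_dvd[OF idx(1)[OF q] 25 c0] dvd_trans by blast
    then have "r \<noteq> p" using p_ndvd[OF q] by (auto simp: c'_def power2_eq_square)
    moreover have "r dvd lehmer c m" using rd idx(3)[OF q] dvd_trans by blast
    ultimately have "r dvd 5" using only[OF r(1)] c5 by auto
    then have "r = 5" using primes_dvd_imp_eq[OF r(1), of 5] by simp
    then show ?thesis using r(2) by simp
  qed
qed

section \<open>Positive solutions as odd powers of the minimal one\<close>

text \<open>Multiplying by \<beta>^2 = \<alpha>^-2 turns a solution into an integral one (u, v) with
  u > 0. If v > 0, then v < y and induction applies; v = 0 is impossible; v < 0 forces the minimal
  solution.\<close>

lemma pos_sol_eq_odd_power:
  assumes k: "k > 1" and l: "l > 0" and kl: "odd (k * l)"
    and min: "minimal_pos_sol k l x1 y1" and sol: "pos_sol k l x y"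
  shows "\<exists>j. sol_val k l x y / 2 = (sol_val k l x1 y1 / 2) ^ (2 * j + 1)"
proof -
  define a b where "a = sqrt (real_of_int k)" and "b = sqrt (real_of_int l)"
  have a2: "a * a = real_of_int k" and b2: "b * b = real_of_int l"
    and a1: "a > 1" and b1: "b \<ge> 1"
    using k l by (simp_all add: a_def b_def)
  have val: "sol_val k l x y = of_int x * a + of_int y * b" for x y
    by (simp add: sol_val_def a_def b_def)
  define \<alpha> \<beta> where "\<alpha> = (of_int x1 * a + of_int y1 * b) / 2"
    and "\<beta> = (of_int x1 * a - of_int y1 * b) / 2"
  have norm: "(of_int x * a + of_int y * b) * (of_int x * a - of_int y * b)
      = of_int (k * x\<^sup>2 - l * y\<^sup>2)" for x y :: int
  proof -
    have "(of_int x * a + of_int y * b) * (of_int x * a - of_int y * b)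
      = (a * a) * (of_int x)\<^sup>2 - (b * b) * (of_int y)\<^sup>2"
      by (simp add: algebra_simps power2_eq_square)
    then show ?thesis unfolding a2 b2 by simp
  qed
  have sol1: "x1 > 0" "y1 > 0" "k * x1\<^sup>2 - l * y1\<^sup>2 = 4"
    using min by (auto simp: minimal_pos_sol_def pos_sol_def)
  have least: "\<alpha> \<le> (of_int u * a + of_int v * b) / 2" if "pos_sol k l u v" for u v
  proof -
    have "sol_val k l x1 y1 \<le> sol_val k l u v"
      using min that by (auto simp: minimal_pos_sol_def)
    then show ?thesis unfolding val \<alpha>_def by (rule divide_right_mono) simp
  qed
  have \<alpha>\<beta>: "\<alpha> * \<beta> = 1" using norm[of x1 y1] sol1(3) by (simp add: \<alpha>_def \<beta>_def)
  have "2 < 1 * a + 1 * b" using a1 b1 by simp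
  also have "\<dots> \<le> of_int x1 * a + of_int y1 * b"
    using sol1 a1 b1 by (intro add_mono mult_right_mono) auto
  finally have \<alpha>1: "\<alpha> > 1" by (simp add: \<alpha>_def)
  have \<beta>0: "\<beta> > 0" using \<alpha>\<beta> \<alpha>1 zero_less_mult_pos[of \<alpha> \<beta>] by simp
  then have "\<beta> * 1 < \<beta> * \<alpha>" using \<alpha>1 by (intro mult_strict_left_mono)
  then have \<beta>1: "\<beta> < 1" using \<alpha>\<beta> by (simp add: mult.commute)
  \<comment> \<open>These are the coordinates of the descent unit: 2 \<alpha>^2 = T + D sqrt(k
    l).\<close>
  define T D where "T = k * x1\<^sup>2 - 2" and "D = x1 * y1"
  have TD: "T\<^sup>2 - k * l * D\<^sup>2 = 4"
  proof -
    have "k * l * D\<^sup>2 = (k * x1\<^sup>2) * (l * y1\<^sup>2)" by (simp add: D_def power_mult_distrib)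
    also have "l * y1\<^sup>2 = k * x1\<^sup>2 - 4" using sol1(3) by simp
    finally show ?thesis by (simp add: T_def power2_eq_square algebra_simps)
  qed
  have same_parity: "even x \<longleftrightarrow> even y" if "k * x\<^sup>2 - l * y\<^sup>2 = 4" for x y :: int
  proof -
    have "even (k * x\<^sup>2 - l * y\<^sup>2)" using that by simp
    then show ?thesis using kl by simp
  qed
  show ?thesis
    using sol
  proof (induction "nat y" arbitrary: x y rule: less_induct)
    case less
    have xy: "x > 0" "y > 0" "k * x\<^sup>2 - l * y\<^sup>2 = 4"
      using less.prems by (auto simp: pos_sol_def)
    define \<eta> \<eta>' where "\<eta> = (of_int x * a + of_int y * b) / 2"
      and "\<eta>' = (of_int x * a - of_int y * b) / 2"
    have \<eta>\<eta>': "\<eta> * \<eta>' = 1" using norm[of x y] xy(3) by (simp add: \<eta>_def \<eta>'_def)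
    have \<eta>0: "\<eta> > 0" using xy a1 b1 by (simp add: \<eta>_def add_pos_pos)
    then have \<eta>'0: "\<eta>' > 0" using \<eta>\<eta>' by (metis zero_less_mult_pos zero_less_one)
    \<comment> \<open>Modulo 2, T and D are both congruent to x1, and x is congruent to y.\<close>
    have "even (x * T - l * y * D)" "even (y * T - k * x * D)"
      using kl same_parity[OF xy(3)] same_parity[OF sol1(3)] by (auto simp: T_def D_def)
    then obtain u v where u: "x * T - l * y * D = 2 * u" and v: "y * T - k * x * D = 2 * v"
      by (elim evenE) blast
    have "4 * (k * u\<^sup>2 - l * v\<^sup>2) = k * (2 * u)\<^sup>2 - l * (2 * v)\<^sup>2"
      by (simp add: power_mult_distrib algebra_simps)
    also have "\<dots> = (k * x\<^sup>2 - l * y\<^sup>2) * (T\<^sup>2 - k * l * D\<^sup>2)"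
      unfolding u[symmetric] v[symmetric] by (simp add: power2_eq_square algebra_simps)
    finally have uv: "k * u\<^sup>2 - l * v\<^sup>2 = 4" unfolding TD xy(3) by simp
    have \<alpha>2: "\<alpha>\<^sup>2 = (of_int T + of_int D * a * b) / 2"
      and \<beta>2: "\<beta>\<^sup>2 = (of_int T - of_int D * a * b) / 2"
    proof -
      have T': "2 * of_int T = (a * a) * (of_int x1)\<^sup>2 + (b * b) * (of_int y1)\<^sup>2"
      proof -
        have "2 * T = k * x1\<^sup>2 + l * y1\<^sup>2" using sol1(3) by (simp add: T_def)
        then have "real_of_int (2 * T) = of_int (k * x1\<^sup>2 + l * y1\<^sup>2)" by simp
        then show ?thesis by (simp add: a2 b2)
      qed
      have "4 * \<alpha>\<^sup>2 = 2 * of_int T + 2 * of_int D * a * b"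
        unfolding T' by (simp add: \<alpha>_def D_def power2_eq_square algebra_simps)
      then show "\<alpha>\<^sup>2 = (of_int T + of_int D * a * b) / 2" by simp
      have "4 * \<beta>\<^sup>2 = 2 * of_int T - 2 * of_int D * a * b"
        unfolding T' by (simp add: \<beta>_def D_def power_divide) (simp add: power2_eq_square algebra_simps)
      then show "\<beta>\<^sup>2 = (of_int T - of_int D * a * b) / 2" by simp
    qed
    have u': "2 * real_of_int u = of_int x * of_int T - (b * b) * of_int y * of_int D"
      using arg_cong[OF u, of real_of_int] by (simp add: b2)
    have v': "2 * real_of_int v = of_int y * of_int T - (a * a) * of_int x * of_int D"
      using arg_cong[OF v, of real_of_int] by (simp add: a2)
    have uv1: "(of_int u * a + of_int v * b) / 2 = \<eta> * \<beta>\<^sup>2"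
    proof -
      have "2 * (of_int u * a + of_int v * b) = 2 * of_int u * a + 2 * of_int v * b" by simp
      also have "\<dots> = 4 * (\<eta> * \<beta>\<^sup>2)"
        unfolding u' v' \<beta>2 \<eta>_def by (simp add: algebra_simps)
      finally show ?thesis by simp
    qed
    have uv2: "(of_int u * a - of_int v * b) / 2 = \<eta>' * \<alpha>\<^sup>2"
    proof -
      have "2 * (of_int u * a - of_int v * b) = 2 * of_int u * a - 2 * of_int v * b" by simp
      also have "\<dots> = 4 * (\<eta>' * \<alpha>\<^sup>2)"
        unfolding u' v' \<alpha>2 \<eta>'_def by (simp add: algebra_simps)
      finally show ?thesis by simp
    qed
    have pos: "\<eta> * \<beta>\<^sup>2 > 0" "\<eta>' * \<alpha>\<^sup>2 > 0"
      using \<eta>0 \<eta>'0 \<alpha>1 \<beta>0 by simp_all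
    have "of_int u * a = \<eta> * \<beta>\<^sup>2 + \<eta>' * \<alpha>\<^sup>2"
      unfolding uv1[symmetric] uv2[symmetric] by (simp add: field_simps)
    then have "of_int u * a > 0" using pos by simp
    then have u0: "u > 0" using a1 by (simp add: zero_less_mult_iff)
    have \<eta>_back: "\<eta> = (\<eta> * \<beta>\<^sup>2) * \<alpha>\<^sup>2"
    proof -
      have "(\<eta> * \<beta>\<^sup>2) * \<alpha>\<^sup>2 = \<eta> * (\<alpha> * \<beta>)\<^sup>2" by (simp add: power_mult_distrib)
      then show ?thesis by (simp add: \<alpha>\<beta>)
    qed
    consider "v > 0" | "v = 0" | "v < 0" by linarith
    then show ?case
    proof cases
      case 1
      have "\<beta>\<^sup>2 < 1" "\<alpha>\<^sup>2 > 1" using \<beta>0 \<beta>1 \<alpha>1 by (simp_all add: power_less_one_iff)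
      then have "\<eta> * \<beta>\<^sup>2 < \<eta>" "\<eta>' < \<eta>' * \<alpha>\<^sup>2" using \<eta>0 \<eta>'0 by simp_all
      moreover have "of_int v * b = \<eta> * \<beta>\<^sup>2 - \<eta>' * \<alpha>\<^sup>2"
        unfolding uv1[symmetric] uv2[symmetric] by (simp add: field_simps)
      moreover have "of_int y * b = \<eta> - \<eta>'"
        by (simp add: \<eta>_def \<eta>'_def field_simps)
      ultimately have "of_int v * b < of_int y * b" by simp
      then have "v < y" using b1 by simp
      then obtain j where "sol_val k l u v / 2 = (sol_val k l x1 y1 / 2) ^ (2 * j + 1)"
        using less.hyps[of v u] 1 u0 uv by (auto simp: pos_sol_def)
      then have "\<eta> * \<beta>\<^sup>2 = \<alpha> ^ (2 * j + 1)" using uv1 by (simp add: val \<alpha>_def)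
      then have "\<eta> = \<alpha> ^ (2 * Suc j + 1)"
        using \<eta>_back by (simp add: power2_eq_square mult_ac)
      then show ?thesis unfolding val \<eta>_def \<alpha>_def by blast
    next
      case 2
      then have ku: "k * u\<^sup>2 = 4" using uv by simp
      then have "even (k * u\<^sup>2)" by simp
      then have "even u" using kl by simp
      then obtain t where "u = 2 * t" by (elim evenE)
      then have "k * t\<^sup>2 = 1" using ku by (simp add: power_mult_distrib)
      then have "k dvd 1" by (metis dvd_triv_left)
      then show ?thesis using k by simp
    next
      case 3
      \<comment> \<open>The solution (u, -v) has half-value \<eta>' \<alpha>^2, so minimality gives
        1 <= \<eta>' \<alpha>, that is \<eta> <= \<alpha>.\<close>
      then have "pos_sol k l u (- v)" using u0 uv by (simp add: pos_sol_def)
      then have "\<alpha> \<le> \<eta>' * \<alpha>\<^sup>2" using least[of u "- v"] uv2 by simp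
      then have "1 \<le> \<eta>' * \<alpha>" using \<alpha>1 by (simp add: power2_eq_square)
      then have "\<eta> * 1 \<le> \<eta> * (\<eta>' * \<alpha>)" using \<eta>0 by (intro mult_left_mono) auto
      then have "\<eta> \<le> \<alpha>" using \<eta>\<eta>' by (simp flip: mult.assoc)
      moreover have "\<alpha> \<le> \<eta>" using least[OF less.prems] by (simp add: \<eta>_def)
      ultimately have "\<eta> = \<alpha> ^ (2 * 0 + 1)" by simp
      then show ?thesis unfolding val \<eta>_def \<alpha>_def by blast
    qed
  qed
qed

text \<open>The conjugate of \<alpha>^m is \<beta>^m, as both invert \<eta>; their sum and
  difference isolate x and y. For odd m the sum is \<alpha>^m - (-\<beta>)^m, and \<sigma> = -1
  contributes the sign.\<close>

lemma pos_sol_coordinates: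
  assumes k: "k > 0" and l: "l > 0" and sol1: "pos_sol k l x1 y1" and sol: "pos_sol k l x y"
    and power: "sol_val k l x y / 2 = (sol_val k l x1 y1 / 2) ^ m" and m: "odd m"
  shows "x = x1 * ((-1) ^ (m div 2) * lehmer (- (k * x1\<^sup>2)) m)"
    and "y = y1 * lehmer (l * y1\<^sup>2) m"
proof -
  define a b where "a = sqrt (real_of_int k)" and "b = sqrt (real_of_int l)"
  have a2: "a\<^sup>2 = real_of_int k" and b2: "b\<^sup>2 = real_of_int l"
    and a0: "a > 0" and b0: "b > 0"
    using k l by (simp_all add: a_def b_def)
  define \<alpha> \<beta> where "\<alpha> = (of_int x1 * a + of_int y1 * b) / 2"
    and "\<beta> = (of_int x1 * a - of_int y1 * b) / 2"
  define \<eta> \<eta>' where "\<eta> = (of_int x * a + of_int y * b) / 2"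
    and "\<eta>' = (of_int x * a - of_int y * b) / 2"
  have norm: "(of_int x * a + of_int y * b) / 2 * ((of_int x * a - of_int y * b) / 2) = 1"
    if "pos_sol k l x y" for x y
  proof -
    have "(of_int x * a + of_int y * b) / 2 * ((of_int x * a - of_int y * b) / 2)
      = (a\<^sup>2 * (of_int x)\<^sup>2 - b\<^sup>2 * (of_int y)\<^sup>2) / 4"
      by (simp add: field_simps power2_eq_square)
    also have "\<dots> = of_int (k * x\<^sup>2 - l * y\<^sup>2) / 4" unfolding a2 b2 by simp
    also have "\<dots> = 1" using that unfolding pos_sol_def by (metis div_self numeral_neq_zero of_int_numeral zero_neq_numeral)
    finally show ?thesis .
  qed
  have \<alpha>\<beta>: "\<alpha> * \<beta> = 1" and \<eta>\<eta>': "\<eta> * \<eta>' = 1"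
    using norm[OF sol1] norm[OF sol] by (simp_all add: \<alpha>_def \<beta>_def \<eta>_def \<eta>'_def)
  have \<eta>: "\<eta> = \<alpha> ^ m"
    using power by (simp add: sol_val_def \<eta>_def \<alpha>_def a_def b_def)
  have "\<eta> * \<beta> ^ m = 1" by (simp add: \<eta> \<alpha>\<beta> flip: power_mult_distrib)
  then have \<eta>': "\<eta>' = \<beta> ^ m" using \<eta>\<eta>' by (metis mult_cancel_left mult_zero_left zero_neq_one)
  have plus: "\<alpha> + \<beta> = of_int x1 * a" and minus: "\<alpha> - \<beta> = of_int y1 * b"
    by (simp_all add: \<alpha>_def \<beta>_def field_simps)
  have mm: "2 * (m div 2) + 1 = m" using m by simp
  have "(\<alpha> - (- \<beta>)) * ((-1) ^ (m div 2) * of_int (lehmer (- (k * x1\<^sup>2)) m)) = \<alpha> ^ m - (- \<beta>) ^ m"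
    unfolding lehmer_def
    by (subst lehmer_aux_closed_form) (use \<alpha>\<beta> mm a2 in \<open>auto simp: plus power_mult_distrib\<close>)
  moreover have "\<alpha> - (- \<beta>) = of_int x1 * a" using plus by simp
  moreover have "\<alpha> ^ m - (- \<beta>) ^ m = of_int x * a"
    using m by (simp add: \<eta>[symmetric] \<eta>'[symmetric]) (simp add: \<eta>_def \<eta>'_def field_simps)
  ultimately have "of_int (x1 * ((-1) ^ (m div 2) * lehmer (- (k * x1\<^sup>2)) m)) * a = of_int x * a"
    by (simp add: mult_ac)
  then show "x = x1 * ((-1) ^ (m div 2) * lehmer (- (k * x1\<^sup>2)) m)"
    using a0 by (metis less_irrefl mult_cancel_right of_int_eq_iff)
  have "(\<alpha> - \<beta>) * (1 ^ (m div 2) * of_int (lehmer (l * y1\<^sup>2) m)) = \<alpha> ^ m - \<beta> ^ m"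
    unfolding lehmer_def
    by (subst lehmer_aux_closed_form) (use \<alpha>\<beta> mm b2 in \<open>auto simp: minus power_mult_distrib\<close>)
  moreover note minus
  moreover have "\<alpha> ^ m - \<beta> ^ m = of_int y * b"
    by (simp add: \<eta>[symmetric] \<eta>'[symmetric]) (simp add: \<eta>_def \<eta>'_def field_simps)
  ultimately have "of_int (y1 * lehmer (l * y1\<^sup>2) m) * b = of_int y * b"
    by (simp add: mult_ac)
  then show "y = y1 * lehmer (l * y1\<^sup>2) m"
    using b0 by (metis less_irrefl mult_cancel_right of_int_eq_iff)
qed

section \<open>Transfer to the two coordinates\<close>

theorem theorem3p11:
  fixes k l x1 y1 x y :: int and \<epsilon> :: real
  assumes "k > 1" and "l > 0" and "coprime k l"
    and "odd (k * l)" and "\<not> (\<exists>m::int. k * l = m\<^sup>2)"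
    and "\<exists>u v::int. odd u \<and> odd v \<and> k * u\<^sup>2 - l * v\<^sup>2 = 4"
    and "minimal_pos_sol k l x1 y1"
    and "\<epsilon> = sol_val k l x1 y1"
    and "pos_sol k l x y"
  shows "(\<forall>(p::int) (n::nat) (x'::int).
            prime p \<and> \<not> p dvd k \<and> n > 0 \<and> x' > 0 \<and> x = p ^ n * x' \<and>
            (\<forall>r::int. prime r \<and> r dvd x' \<longrightarrow> r dvd k) \<and>
            (k, l, x, y) \<noteq> (5, 1, 75025, 167761) \<longrightarrow>
            sol_val k l x y / 2 = \<epsilon> / 2 \<or>
            (\<exists>q::nat. prime q \<and> odd q \<and> int q \<noteq> p \<and> sol_val k l x y / 2 = (\<epsilon> / 2) ^ q))
       \<and> (\<forall>(p::int) (n::nat) (y'::int).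
            prime p \<and> \<not> p dvd l \<and> n > 0 \<and> y' > 0 \<and> y = p ^ n * y' \<and>
            (\<forall>r::int. prime r \<and> r dvd y' \<longrightarrow> r dvd l) \<longrightarrow>
            sol_val k l x y / 2 = \<epsilon> / 2 \<or>
            (\<exists>q::nat. prime q \<and> odd q \<and> int q \<noteq> p \<and> sol_val k l x y / 2 = (\<epsilon> / 2) ^ q))"
proof -
  note k = assms(1) and l = assms(2) and kl = assms(4) and min = assms(7)
  have sol1: "pos_sol k l x1 y1" using min by (simp add: minimal_pos_sol_def)
  then have eq1: "x1 > 0" "y1 > 0" "k * x1\<^sup>2 - l * y1\<^sup>2 = 4" by (auto simp: pos_sol_def)
  have power: "\<exists>m. odd m \<and> sol_val k l u v / 2 = (sol_val k l x1 y1 / 2) ^ m"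
    if "pos_sol k l u v" for u v
  proof -
    obtain j where "sol_val k l u v / 2 = (sol_val k l x1 y1 / 2) ^ (2 * j + 1)"
      using pos_sol_eq_odd_power[OF k l kl min \<open>pos_sol k l u v\<close>] by blast
    then show ?thesis by (intro exI[of _ "2 * j + 1"]) simp
  qed
  have k0: "k > 0" using k by simp
  \<comment> \<open>x1 and y1 divide the respective coordinates of every positive solution, in
    particular of an odd one.\<close>
  have odd1: "odd x1" "odd y1"
  proof -
    obtain u v :: int where uv: "odd u" "odd v" "k * u\<^sup>2 - l * v\<^sup>2 = 4" using assms(6) by blast
    then have abs_sol: "pos_sol k l \<bar>u\<bar> \<bar>v\<bar>" by (auto simp: pos_sol_def)
    obtain m where "odd m" "sol_val k l \<bar>u\<bar> \<bar>v\<bar> / 2 = (sol_val k l x1 y1 / 2) ^ m"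
      using power[OF abs_sol] by blast
    note co = pos_sol_coordinates[OF k0 l sol1 abs_sol this(2,1)]
    have "x1 dvd \<bar>u\<bar>" "y1 dvd \<bar>v\<bar>" using co by (metis dvd_triv_left)+
    then show "odd x1" "odd y1" using uv(1,2) dvd_trans by auto
  qed
  obtain m where m: "odd m" and val: "sol_val k l x y / 2 = (\<epsilon> / 2) ^ m"
    using power[OF assms(9)] assms(8) by blast
  note co = pos_sol_coordinates[OF k0 l sol1 assms(9) val[unfolded assms(8)] m]
  show ?thesis
  proof (cases "m = 1")
    case True
    then have "sol_val k l x y / 2 = \<epsilon> / 2" using val by simp
    then show ?thesis by blast
  next
    case False
    then have m1: "m > 1" using m by (cases m) auto
    \<comment> \<open>This supplies \<open>p2\<close> of
      \<open>lehmer_few_primes_index\<close>.\<close>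
    have sq: "p\<^sup>2 dvd d * w\<^sup>2" if "prime p" "\<not> p dvd d" "p dvd d * w\<^sup>2" for p d w :: int
    proof -
      have "p dvd w" using that by (auto simp: prime_dvd_mult_iff dest: prime_dvd_power)
      then show ?thesis by (simp add: dvd_power_same)
    qed
    have primes: "r = p \<or> r dvd d"
      if "prime r" "r dvd p ^ n * w" "prime p" "\<forall>r. prime r \<and> r dvd w \<longrightarrow> r dvd d"
      for r p d w :: int and n :: nat
    proof -
      have "r dvd p ^ n \<or> r dvd w" using that(1,2) prime_dvd_mult_iff by blast
      then show ?thesis
        using that prime_dvd_power primes_dvd_imp_eq by metis
    qed
    show ?thesis
    proof (intro conjI allI impI, goal_cases)
      case (1 p n x')
      let ?c = "- (k * x1\<^sup>2)"
      have "l * y1\<^sup>2 > 0" using l eq1(2) by simp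
      then have c5: "?c \<le> -5" using eq1(3) by linarith
      have only: "r = p \<or> r dvd ?c" if "prime r" "r dvd lehmer ?c m" for r
      proof -
        have "r dvd x" using that(2) by (subst co(1)) (simp add: dvd_mult)
        then have "r = p \<or> r dvd k" using primes[OF that(1), of p n x' k] 1 by auto
        then show ?thesis by auto
      qed
      have "(prime m \<and> int m \<noteq> p) \<or> (?c = -5 \<and> m = 25)"
        using kl odd1 c5 1 sq[of p k x1] m m1 only
        by (intro lehmer_few_primes_index) auto
      then show ?case
      proof
        assume "?c = -5 \<and> m = 25"
        \<comment> \<open>Only 5x^2 - y^2 = 4 with minimal solution (1, 1) remains. Then \<alpha> is
          the golden ratio, and its 25th power gives the Fibonacci and Lucas numbers 75025 and
          167761.\<close>
        then have c: "k * x1\<^sup>2 = 5" and [simp]: "m = 25" by auto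
        have "k dvd 5" using c by (metis dvd_triv_left)
        moreover have "prime (5::int)" by simp
        moreover have "0 \<le> k" using k by simp
        ultimately have "k = 1 \<or> k = 5" unfolding prime_int_iff by blast
        then have "k = 5" using k by simp
        then have "x1 = 1" using c eq1(1) by (simp add: power2_eq_1_iff)
        have "l * y1\<^sup>2 = 1" using c eq1(3) by simp
        then have "l = 1" using l by (metis dvd_triv_left zdvd1_eq abs_of_pos)
        then have "y1 = 1" using \<open>l * y1\<^sup>2 = 1\<close> eq1(2) by (simp add: power2_eq_1_iff)
        have "x = 75025" "y = 167761"
          using co \<open>k = 5\<close> \<open>l = 1\<close> \<open>x1 = 1\<close> \<open>y1 = 1\<close>
            lehmer_mult[of 5 5 "-5"] lehmer_mult[of 5 5 1] by (simp_all add: lehmer_5)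
        then show ?thesis using 1 \<open>k = 5\<close> \<open>l = 1\<close> by simp
      qed (use m val in blast)
    next
      case (2 p n y')
      let ?c = "l * y1\<^sup>2"
      have c1: "?c > 0" using l eq1(2) by simp
      have only: "r = p \<or> r dvd ?c" if "prime r" "r dvd lehmer ?c m" for r
      proof -
        have "r dvd y" using that(2) by (subst co(2)) (simp add: dvd_mult)
        then have "r = p \<or> r dvd l" using primes[OF that(1), of p n y' l] 2 by auto
        then show ?thesis by auto
      qed
      have "(prime m \<and> int m \<noteq> p) \<or> (?c = -5 \<and> m = 25)"
        using kl odd1 c1 2 sq[of p l y1] m m1 only
        by (intro lehmer_few_primes_index) auto
      \<comment> \<open>The parameter is positive here, so no exception arises.\<close>
      then show ?case using c1 m val by auto
    qed
  qed
qed

end
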